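(* Let $\Omega\subset\mathbb{R}^d$ be a bounded domain with smooth boundary, $0<T<T_1<T_2$, $f\in C_0^\infty(\Omega)$ with $f\not\equiv0$, and $x_0\in\Omega$. Let $\mathcal{M}$ be the set of all $\mu\in H^1_{loc}(0,\infty)$ with $\mu\not\equiv 0$ and $\mu(t)=0$ for $t\ge T$, and for $\mu\in\mathcal{M}$ let $u_\mu$ be the solution of $$\partial_t u=\Delta u+\mu(t)f(x)\ \ (x\in\Omega,\ t>0),\qquad u(x,0)=0\ \ (x\in\Omega),\qquad u(x,t)=0\ \ (x\in\partial\Omega,\ t>0).$$ Say that uniqueness holds if, for all $\mu_1,\mu_2\in\mathcal{M}$, $u_{\mu_1}(x_0,t)=u_{\mu_2}(x_0,t)$ for $T_1<t<T_2$ implies $\mu_1(t)=\mu_2(t)$ for $0<t<T$. Then uniqueness holds only if $d\ge2$; that is, if $d=1$, uniqueness always fails (for every such $\Omega,T,T_1,T_2,f,x_0$).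
   Context: $H^1_{loc}(0,\infty)$ is the set of $\mu$ such that $\mu|_{(0,T_0)}\in H^1(0,T_0)$ for every $T_0>0$. The solution $u_\mu$ is continuous on $\overline{\Omega}\times[T_1,T_2]$, so $u_\mu(x_0,t)$ is well defined. *)

theory Defs
  imports "HOL-Analysis.Analysis"
begin

definition partial_deriv :: "'a::euclidean_space \<Rightarrow> ('a \<Rightarrow> 'b::real_normed_vector) \<Rightarrow> 'a \<Rightarrow> 'b" where
  "partial_deriv v g x = frechet_derivative g (at x) v"

definition laplacian :: "('a::euclidean_space \<Rightarrow> real) \<Rightarrow> 'a \<Rightarrow> real" where
  "laplacian g x = (\<Sum>i\<in>Basis. partial_deriv i (partial_deriv i g) x)"

(* Meant for open S: derivatives are taken with respect to full neighbourhoods. *)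
fun Ck_on :: "nat \<Rightarrow> 'a::euclidean_space set \<Rightarrow> ('a \<Rightarrow> 'b::real_normed_vector) \<Rightarrow> bool" where
  "Ck_on 0 S g \<longleftrightarrow> continuous_on S g"
| "Ck_on (Suc k) S g \<longleftrightarrow>
     (\<forall>x\<in>S. g differentiable (at x)) \<and> (\<forall>v. Ck_on k S (partial_deriv v g))"

definition smooth_on :: "'a::euclidean_space set \<Rightarrow> ('a \<Rightarrow> 'b::real_normed_vector) \<Rightarrow> bool" where
  "smooth_on S g \<longleftrightarrow> (\<forall>k. Ck_on k S g)"

(* Elements of C_0^infinity(S) are represented by their extension by zero to the whole space. *)
definition test_function :: "'a::euclidean_space set \<Rightarrow> ('a \<Rightarrow> real) \<Rightarrow> bool" where
  "test_function S \<phi> \<longleftrightarrow>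
     smooth_on UNIV \<phi> \<and> compact (closure {x. \<phi> x \<noteq> 0}) \<and> closure {x. \<phi> x \<noteq> 0} \<subseteq> S"

(* Near every boundary point a smooth diffeomorphism straightens the boundary, mapping the
   part of the domain onto the part of an open set lying in a coordinate half-space. *)
definition smooth_boundary :: "'a::euclidean_space set \<Rightarrow> bool" where
  "smooth_boundary \<Omega> \<longleftrightarrow>
     (\<forall>p\<in>frontier \<Omega>. \<exists>U V (\<Phi> :: 'a \<Rightarrow> 'a) \<Psi>. \<exists>e\<in>Basis.
        open U \<and> open V \<and> p \<in> U \<and> homeomorphism U V \<Phi> \<Psi> \<and>
        smooth_on U \<Phi> \<and> smooth_on V \<Psi> \<and>
        \<Phi> ` (U \<inter> \<Omega>) = {y \<in> V. y \<bullet> e > 0} \<and>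
        \<Phi> ` (U \<inter> frontier \<Omega>) = {y \<in> V. y \<bullet> e = 0})"

definition smooth_bounded_domain :: "'a::euclidean_space set \<Rightarrow> bool" where
  "smooth_bounded_domain \<Omega> \<longleftrightarrow>
     open \<Omega> \<and> connected \<Omega> \<and> \<Omega> \<noteq> {} \<and> bounded \<Omega> \<and> smooth_boundary \<Omega>"

definition L2_on :: "real set \<Rightarrow> (real \<Rightarrow> real) \<Rightarrow> bool" where
  "L2_on S g \<longleftrightarrow>
     g \<in> borel_measurable (lebesgue_on S) \<and> integrable (lebesgue_on S) (\<lambda>t. (g t)\<^sup>2)"

definition weak_derivative_on :: "real set \<Rightarrow> (real \<Rightarrow> real) \<Rightarrow> (real \<Rightarrow> real) \<Rightarrow> bool" where
  "weak_derivative_on S g g' \<longleftrightarrow>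
     (\<forall>\<phi>. test_function S \<phi> \<longrightarrow>
        (LINT t|lebesgue_on S. g t * deriv \<phi> t) = - (LINT t|lebesgue_on S. g' t * \<phi> t))"

definition H1_on :: "real set \<Rightarrow> (real \<Rightarrow> real) \<Rightarrow> bool" where
  "H1_on S g \<longleftrightarrow> L2_on S g \<and> (\<exists>g'. L2_on S g' \<and> weak_derivative_on S g g')"

definition H1_loc :: "(real \<Rightarrow> real) \<Rightarrow> bool" where
  "H1_loc \<mu> \<longleftrightarrow> (\<forall>T0>0. H1_on {0<..<T0} \<mu>)"

(* The class of admissible time factors. An element of H1_loc is an equivalence class modulo
   null sets with a unique continuous representative; it is this representative that is used,
   so that pointwise (in)equalities of classes make sense. Values at t <= 0 play no role. *)
definition admissible :: "real \<Rightarrow> (real \<Rightarrow> real) set" where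
  "admissible T =
     {\<mu>. H1_loc \<mu> \<and> continuous_on {0<..} \<mu> \<and> (\<exists>t>0. \<mu> t \<noteq> 0) \<and> (\<forall>t\<ge>T. \<mu> t = 0)}"

definition C21_on :: "'a::euclidean_space set \<Rightarrow> ('a \<Rightarrow> real \<Rightarrow> real) \<Rightarrow> bool" where
  "C21_on \<Omega> u \<longleftrightarrow>
     (\<forall>x\<in>\<Omega>. \<forall>t>0. (\<lambda>s. u x s) differentiable (at t)) \<and>
     (\<forall>t>0. Ck_on 2 \<Omega> (\<lambda>x. u x t)) \<and>
     continuous_on (\<Omega> \<times> {0<..}) (\<lambda>(x, t). deriv (\<lambda>s. u x s) t) \<and>
     (\<forall>i\<in>Basis. continuous_on (\<Omega> \<times> {0<..}) (\<lambda>(x, t). partial_deriv i (\<lambda>y. u y t) x)) \<and>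
     (\<forall>i\<in>Basis. \<forall>j\<in>Basis. continuous_on (\<Omega> \<times> {0<..})
        (\<lambda>(x, t). partial_deriv i (partial_deriv j (\<lambda>y. u y t)) x))"

(* Classical solutions. Since \<mu> is continuous and f is a test function, the solution of the
   initial-boundary value problem is classical, and it is unique by the maximum principle. *)
definition heat_solution ::
    "'a::euclidean_space set \<Rightarrow> ('a \<Rightarrow> real) \<Rightarrow> (real \<Rightarrow> real) \<Rightarrow> ('a \<Rightarrow> real \<Rightarrow> real) \<Rightarrow> bool" where
  "heat_solution \<Omega> f \<mu> u \<longleftrightarrow>
     continuous_on (closure \<Omega> \<times> {0..}) (\<lambda>(x, t). u x t) \<and>
     C21_on \<Omega> u \<and>
     (\<forall>x\<in>\<Omega>. \<forall>t>0. deriv (\<lambda>s. u x s) t = laplacian (\<lambda>y. u y t) x + \<mu> t * f x) \<and>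
     (\<forall>x\<in>\<Omega>. u x 0 = 0) \<and>
     (\<forall>x\<in>frontier \<Omega>. \<forall>t>0. u x t = 0)"

(* u1 and u2 range over all solutions because u_\<mu> is determined only on closure \<Omega> \<times> {0..}. *)
definition uniqueness_holds ::
    "'a::euclidean_space set \<Rightarrow> real \<Rightarrow> real \<Rightarrow> real \<Rightarrow> ('a \<Rightarrow> real) \<Rightarrow> 'a \<Rightarrow> bool" where
  "uniqueness_holds \<Omega> T T1 T2 f x0 \<longleftrightarrow>
     (\<forall>\<mu>1\<in>admissible T. \<forall>\<mu>2\<in>admissible T. \<forall>u1 u2.
        heat_solution \<Omega> f \<mu>1 u1 \<longrightarrow> heat_solution \<Omega> f \<mu>2 u2 \<longrightarrow>
        (\<forall>t. T1 < t \<and> t < T2 \<longrightarrow> u1 x0 t = u2 x0 t) \<longrightarrow>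
        (\<forall>t. 0 < t \<and> t < T \<longrightarrow> \<mu>1 t = \<mu>2 t))"

end

(*
  In one dimension a source supported in a finite time interval can produce a temperature that
  vanishes identically after that interval (flatness). For \<Omega> = (0, L), put
  S(x, z) = sinh (x \<surd>z) / \<surd>z, which is entire in z. Replacing z by d/dt, let
  \<mu> = S(L, d/dt) g for a bump g supported in [0, T]. In the Laplace variable the solution is then
    [S(x, z) \<integral>\<^sub>0\<^sup>L S(L - y, z) f(y) dy - S(L, z) \<integral>\<^sub>0\<^sup>x S(x - y, z) f(y) dy] g(z);
  its Taylor coefficients in z are the functions profile k below, and u = \<Sum>k. profile k * g^(k).
  All these series converge if g is of Gevrey order two with a small constant, as is
  exp (- A / t - A / (T - t)) for large A. So \<mu> and 2 \<mu> give the same (zero) observation on (T1, T2).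
*)
theory Submission
  imports Defs "HOL-Complex_Analysis.Cauchy_Integral_Formula" "HOL-Real_Asymp.Real_Asymp"
begin

text \<open>The factor S(L, z) is dictated by poles: its zeros -(n pi / L)^2 are the eigenvalues of
  the Dirichlet Laplacian, so multiplying by it turns the resolvent into an entire function of z. In
  one dimension these eigenvalues grow quadratically, so S(L, z) has order 1/2 and its k-th
  coefficient decays like L^(2k) / (2k)!. This leaves room for derivatives of g that grow like
  (k!)^2 rho^k. Growth beyond k! is unavoidable, because a non-zero function of compact support is
  not analytic. In dimension d the eigenvalue count suggests order d/2, hence coefficients too large
  for any such g. The quotient of (k!)^2 by (2k)! is only geometric. Hence mere smoothness of g does
  not suffice, and rho has to be small compared with 1 / L^2.\<close>

section \<open>A compactly supported function of Gevrey order two\<close>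

lemma power_le_fact_exp:
  fixes y :: real
  assumes "0 \<le> y"
  shows "y ^ k * exp (- y) \<le> fact k"
proof -
  have "(\<Sum>n\<in>{k}. y ^ n /\<^sub>R fact n) \<le> (\<Sum>n. y ^ n /\<^sub>R fact n)"
    using assms by (intro sum_le_suminf summable_exp_generic) auto
  then have "y ^ k / fact k \<le> exp y"
    by (simp add: exp_def divide_inverse mult.commute)
  then show ?thesis
    by (simp add: exp_minus field_simps)
qed

text \<open>On this disc \<open>Re z\<close> is at least t/2 and \<open>norm z\<close> at most 3t/2.
  The constant 2/9 is (1/2) / (3/2)^2, from Re (1/z) = Re z / |z|^2.\<close>

lemma Re_inverse_ge:
  fixes z :: complex
  assumes "0 < t" and "norm (z - of_real t) \<le> t / 2"
  shows "2 / (9 * t) \<le> Re (1 / z)"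
proof -
  have re: "t / 2 \<le> Re z"
    using complex_Re_le_cmod[of "of_real t - z"] assms(2) by (simp add: norm_minus_commute)
  have "norm z \<le> norm (z - of_real t) + norm (of_real t :: complex)"
    by (metis diff_add_cancel norm_triangle_ineq)
  then have "norm z \<le> 3 * t / 2"
    using assms by simp
  then have "(norm z)\<^sup>2 \<le> (3 * t / 2)\<^sup>2"
    by (intro power_mono) auto
  moreover have "0 < (norm z)\<^sup>2"
    using re assms(1) by auto
  ultimately have "(t / 2) / (3 * t / 2)\<^sup>2 \<le> Re z / (norm z)\<^sup>2"
    using re assms(1) by (intro frac_le) auto
  also have "(t / 2) / (3 * t / 2)\<^sup>2 = 2 / (9 * t)"
    using assms(1) by (simp add: power2_eq_square field_simps)
  finally show ?thesis
    by (simp add: Re_divide cmod_power2)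
qed

text \<open>Each of the two factorials has its own source. Cauchy's inequality on a disc of radius r
  proportional to the distance \<open>m t\<close> to the nearer endpoint costs k! / r^k, and the
  decay exp (- const / m t) of the function on that disc turns r^(-k) into the second k!.\<close>

lemma gevrey_bump_exists:
  fixes T \<rho> :: real
  assumes T: "0 < T" and \<rho>: "0 < \<rho>"
  shows "\<exists>g :: nat \<Rightarrow> real \<Rightarrow> real.
    (\<forall>k t. (g k has_real_derivative g (Suc k) t) (at t)) \<and>
    (\<forall>k t. \<bar>g k t\<bar> \<le> (fact k)\<^sup>2 * \<rho> ^ k) \<and>
    (\<forall>k t. t \<le> 0 \<or> T \<le> t \<longrightarrow> g k t = 0) \<and>
    (\<forall>t. 0 < t \<and> t < T \<longrightarrow> 0 < g 0 t)"
proof -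
  \<comment> \<open>Chosen so that 2 / m = \<rho> * (2 * A / (9 * m)); then
    \<open>power_le_fact_exp\<close> gives exactly \<rho>^k * k! in \<open>pw\<close>.\<close>
  define A where "A = 9 / \<rho>"
  have A: "0 < A" "9 / A = \<rho>"
    using \<rho> by (auto simp: A_def)
  define G where "G = (\<lambda>z::complex. exp (- of_real A * (1 / z) - of_real A * (1 / (of_real T - z))))"
  define V where "V = - {0, complex_of_real T}"
  have V: "open V"
    unfolding V_def by (simp add: open_Compl)
  have holG: "G holomorphic_on V"
    unfolding G_def V_def by (intro holomorphic_intros) auto
  define m where "m = (\<lambda>t. min t (T - t))"
  define g where "g = (\<lambda>k t. if 0 < t \<and> t < T then Re ((deriv ^^ k) G (of_real t)) else 0)"

  have raw: "\<bar>g k t\<bar> \<le> fact k * ((2 / m t) ^ k * exp (- (2 * A / (9 * m t))))"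
    if t: "0 < t" "t < T" for k t
  proof -
    \<comment> \<open>With this radius the disc meets the hypothesis of \<open>Re_inverse_ge\<close>
      for both endpoints at once.\<close>
    define r where "r = m t / 2"
    have r: "0 < r" "r \<le> t / 2" "r \<le> (T - t) / 2"
      using t by (auto simp: r_def m_def)
    have sub: "cball (of_real t) r \<subseteq> V"
    proof
      fix z assume "z \<in> cball (complex_of_real t) r"
      then have "norm (z - of_real t) \<le> r"
        by (simp add: dist_norm norm_minus_commute)
      then show "z \<in> V"
        using r t norm_of_real[of "T - t", where 'a = complex] by (auto simp: V_def)
    qed
    have bd: "norm (G z) \<le> exp (- (2 * A / (9 * m t)))" if z: "norm (of_real t - z) = r" for z
    proof -
      have 1: "2 / (9 * t) \<le> Re (1 / z)"
        using r t z by (intro Re_inverse_ge) (auto simp: norm_minus_commute)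
      have "norm ((of_real T - z) - of_real (T - t)) \<le> (T - t) / 2"
        using r z by simp
      then have 2: "2 / (9 * (T - t)) \<le> Re (1 / (of_real T - z))"
        using t by (intro Re_inverse_ge) auto
      have "0 \<le> 2 / (9 * t)" "0 \<le> 2 / (9 * (T - t))"
        using t by auto
      with 1 2 have nonneg: "0 \<le> Re (1 / z)" "0 \<le> Re (1 / (of_real T - z))"
        by (meson order_trans)+
      \<comment> \<open>The nearer endpoint alone supplies the decay; of the other summand only the
        sign matters.\<close>
      have "2 / (9 * m t) = 2 / (9 * t) \<or> 2 / (9 * m t) = 2 / (9 * (T - t))"
        by (simp add: m_def min_def)
      then have "2 / (9 * m t) \<le> Re (1 / z) + Re (1 / (of_real T - z))"
        using 1 2 nonneg by (metis add_increasing add_increasing2)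
      then have le: "A * (2 / (9 * m t)) \<le> A * (Re (1 / z) + Re (1 / (of_real T - z)))"
        using A by (intro mult_left_mono) auto
      have Re_eq: "Re (- of_real A * w - of_real A * w') = - (A * (Re w + Re w'))" for w w'
        by (simp add: algebra_simps)
      show ?thesis
        using le unfolding G_def norm_exp_eq_Re Re_eq by simp
    qed
    have "norm ((deriv ^^ k) G (of_real t)) \<le> fact k * exp (- (2 * A / (9 * m t))) / r ^ k"
    proof (rule Cauchy_inequality)
      show "G holomorphic_on ball (of_real t) r"
        using holG sub ball_subset_cball holomorphic_on_subset by blast
      show "continuous_on (cball (of_real t) r) G"
        using holG sub holomorphic_on_imp_continuous_on continuous_on_subset by blast
    qed (use r bd in auto)
    also have "\<dots> = fact k * ((2 / m t) ^ k * exp (- (2 * A / (9 * m t))))"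
      by (simp add: r_def power_divide)
    finally have "norm ((deriv ^^ k) G (of_real t)) \<le> fact k * ((2 / m t) ^ k * exp (- (2 * A / (9 * m t))))" .
    then show ?thesis
      using t abs_Re_le_cmod[of "(deriv ^^ k) G (of_real t)"] by (simp add: g_def)
  qed

  have pw: "(2 / m t) ^ k * exp (- (2 * A / (9 * m t))) \<le> \<rho> ^ k * fact k"
    if t: "0 < t" "t < T" for k t
  proof -
    have "(2 / m t) = \<rho> * (2 * A / (9 * m t))"
      using A t \<rho> by (simp add: A_def)
    then have "(2 / m t) ^ k * exp (- (2 * A / (9 * m t)))
        = \<rho> ^ k * ((2 * A / (9 * m t)) ^ k * exp (- (2 * A / (9 * m t))))"
      by (metis mult.assoc power_mult_distrib)
    also have "\<dots> \<le> \<rho> ^ k * fact k"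
      using A t \<rho> by (intro mult_left_mono power_le_fact_exp) (auto simp: m_def)
    finally show ?thesis .
  qed

  have bound: "\<bar>g k t\<bar> \<le> (fact k)\<^sup>2 * \<rho> ^ k" for k t
  proof (cases "0 < t \<and> t < T")
    case True
    have "\<bar>g k t\<bar> \<le> fact k * (\<rho> ^ k * fact k)"
      using raw[of t k] pw[of t k] True by (meson fact_ge_zero mult_left_mono order_trans)
    then show ?thesis
      by (simp add: power2_eq_square algebra_simps)
  next
    case False
    then show ?thesis
      using \<rho> by (auto simp: g_def)
  qed

  \<comment> \<open>Two powers of \<open>m t\<close> are set aside and paid for by \<open>pw\<close>
    at k + 2. Vanishing to second order makes the difference quotient tend to 0 at every point
    outside (0, T), the junctions 0 and T included.\<close>
  have flat: "\<bar>g k t\<bar> \<le> (fact k * (\<rho> ^ (k + 2) * fact (k + 2))) * \<bar>t - \<tau>\<bar>\<^sup>2"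
    if \<tau>: "\<tau> \<le> 0 \<or> T \<le> \<tau>" for k t \<tau>
  proof (cases "0 < t \<and> t < T")
    case True
    then have m: "0 < m t" "m t \<le> \<bar>t - \<tau>\<bar>"
      using \<tau> by (auto simp: m_def)
    have "(2 / m t) ^ k * exp (- (2 * A / (9 * m t)))
        = (m t)\<^sup>2 / 4 * ((2 / m t) ^ (k + 2) * exp (- (2 * A / (9 * m t))))"
      using m by (simp add: power_add power2_eq_square)
    also have "\<dots> \<le> \<bar>t - \<tau>\<bar>\<^sup>2 * (\<rho> ^ (k + 2) * fact (k + 2))"
    proof (rule mult_mono)
      have "(m t)\<^sup>2 \<le> \<bar>t - \<tau>\<bar>\<^sup>2"
        using m by (intro power_mono) auto
      then show "(m t)\<^sup>2 / 4 \<le> \<bar>t - \<tau>\<bar>\<^sup>2"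
        using zero_le_power2[of "m t"] by linarith
      show "(2 / m t) ^ (k + 2) * exp (- (2 * A / (9 * m t))) \<le> \<rho> ^ (k + 2) * fact (k + 2)"
        using pw[of t "k + 2"] True by blast
    qed (use m in auto)
    finally have "fact k * ((2 / m t) ^ k * exp (- (2 * A / (9 * m t))))
        \<le> fact k * (\<bar>t - \<tau>\<bar>\<^sup>2 * (\<rho> ^ (k + 2) * fact (k + 2)))"
      by (intro mult_left_mono) auto
    with raw[of t k] True show ?thesis
      by (simp add: algebra_simps)
  next
    case False
    then show ?thesis
      using \<rho> by (auto simp: g_def)
  qed

  have deriv: "(g k has_real_derivative g (Suc k) t) (at t)" for k t
  proof (cases "0 < t \<and> t < T")
    case True
    have "((deriv ^^ k) G has_field_derivative (deriv ^^ Suc k) G (of_real t)) (at (of_real t))"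
      using holG V True by (intro has_field_derivative_higher_deriv) (auto simp: V_def)
    then have "((\<lambda>s. (deriv ^^ k) G (of_real s)) has_vector_derivative (deriv ^^ Suc k) G (of_real t)) (at t)"
      by (rule has_vector_derivative_real_field)
    then have "((\<lambda>s. Re ((deriv ^^ k) G (of_real s))) has_real_derivative g (Suc k) t) (at t)"
      using has_field_derivative_Re True by (fastforce simp: g_def)
    then show ?thesis
      by (rule has_field_derivative_transform_within_open[where S = "{0<..<T}"])
        (use True in \<open>auto simp: g_def\<close>)
  next
    case False
    define C where "C = fact k * (\<rho> ^ (k + 2) * fact (k + 2))"
    \<comment> \<open>The instance s = t also shows \<open>g k t = 0\<close>.\<close>
    have C: "\<bar>g k s\<bar> \<le> C * \<bar>s - t\<bar>\<^sup>2" for s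
      unfolding C_def using False by (intro flat) auto
    have "((\<lambda>s. (g k s - g k t) / (s - t)) \<longlongrightarrow> 0) (at t)"
    proof (rule Lim_null_comparison)
      show "\<forall>\<^sub>F s in at t. norm ((g k s - g k t) / (s - t)) \<le> C * \<bar>s - t\<bar>"
      proof (rule eventually_at_filter[THEN iffD2], rule always_eventually, intro allI impI)
        fix s assume "s \<noteq> t"
        then show "norm ((g k s - g k t) / (s - t)) \<le> C * \<bar>s - t\<bar>"
          using C[of s] C[of t] by (simp add: abs_divide divide_le_eq power2_eq_square algebra_simps)
      qed
      show "((\<lambda>s. C * \<bar>s - t\<bar>) \<longlongrightarrow> 0) (at t)"
        by (auto intro!: tendsto_eq_intros)
    qed
    then have "(g k has_real_derivative 0) (at t)"
      by (simp add: has_field_derivative_iff)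
    moreover have "g (Suc k) t = 0"
      using False by (auto simp: g_def)
    ultimately show ?thesis
      by simp
  qed

  have pos: "0 < g 0 t" if "0 < t" "t < T" for t
  proof -
    have "G (of_real t) = of_real (exp (- A * (1 / t) - A * (1 / (T - t))))"
      unfolding G_def by (simp flip: exp_of_real)
    then show ?thesis
      using that by (simp add: g_def)
  qed

  show ?thesis
    using deriv bound pos by (intro exI[of _ g]) (auto simp: g_def)
qed

section \<open>Series in the derivatives of the bump\<close>

text \<open>\<open>g k\<close> is the k-th derivative of \<open>g 0\<close>. L will be the length of
  the interval; it enters the conditions on g only through the Gevrey constant.\<close>

locale gevrey_bump =
  fixes g :: "nat \<Rightarrow> real \<Rightarrow> real" and T L :: real
  assumes T_pos: "0 < T" and L_pos: "0 < L"
    and bump_deriv: "(g k has_real_derivative g (Suc k) t) (at t)"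
    and bump_bound: "\<bar>g k t\<bar> \<le> (fact k)\<^sup>2 * (1 / (8 * L\<^sup>2)) ^ k"
    and bump_zero: "t \<le> 0 \<or> T \<le> t \<Longrightarrow> g k t = 0"
    and bump_pos: "0 < t \<Longrightarrow> t < T \<Longrightarrow> 0 < g 0 t"
begin

lemma bump_continuous_on [continuous_intros]:
  assumes "continuous_on S f"
  shows "continuous_on S (\<lambda>x. g k (f x))"
proof -
  have "continuous_on UNIV (g k)"
    using bump_deriv by (meson DERIV_isCont continuous_at_imp_continuous_on)
  then show ?thesis
    using assms continuous_on_compose2 by blast
qed

text \<open>The Gevrey constant \<open>1 / (8 * L\<^sup>2)\<close> is half the radius \<open>1 / (2 * L)\<^sup>2\<close> at which
  the series with coefficients \<open>weight k\<close> would cease to converge.\<close>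

definition weight :: "nat \<Rightarrow> real" where
  "weight k = real (Suc k) * (2 * L) ^ (2 * k) / fact (2 * k)"

text \<open>It serves \<open>g k\<close> and \<open>g (k + 1)\<close> together: one factor k + 1
  comes from \<open>weight\<close>, two more from ((k+1)!)^2 = (k+1)^2 (k!)^2, and the leading
  constant absorbs the extra factor 1 / (8 L^2) of the higher derivative.\<close>

definition majorant :: "nat \<Rightarrow> real" where
  "majorant k = (1 + 1 / (8 * L\<^sup>2)) * (real (Suc k) ^ 3 * (1 / 2) ^ k)"

lemma summable_majorant: "summable majorant"
proof -
  have "summable (\<lambda>k. norm ((3 / 4 :: real) ^ k))"
    by (simp add: power_abs)
  moreover have "(\<lambda>k. real (Suc k) ^ 3 * (1 / 2) ^ k) \<in> O(\<lambda>k. (3 / 4) ^ k)"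
    by real_asymp
  ultimately have "summable (\<lambda>k. real (Suc k) ^ 3 * (1 / 2) ^ k)"
    by (rule summable_comparison_test_bigo)
  then show ?thesis
    unfolding majorant_def by (rule summable_mult)
qed

lemma weight_nonneg: "0 \<le> weight k"
  using L_pos by (simp add: weight_def)

text \<open>The geometric factor is (2L)^2 / (8 L^2) = 1/2, and (k!)^2 is at most (2k)!.\<close>

lemma weight_mult_bound: "weight k * ((fact k)\<^sup>2 * (1 / (8 * L\<^sup>2)) ^ k) \<le> real (Suc k) * (1 / 2) ^ k"
proof -
  have half: "(2 * L) ^ (2 * k) * (1 / (8 * L\<^sup>2)) ^ k = (1 / 2) ^ k"
  proof -
    have "(2 * L)\<^sup>2 * (1 / (8 * L\<^sup>2)) = 1 / 2"
      using L_pos by (simp add: field_simps power2_eq_square)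
    then show ?thesis
      by (metis power_mult power_mult_distrib)
  qed
  have "(fact k)\<^sup>2 / fact (2 * k) \<le> (1 :: real)"
    using square_fact_le_2_fact[of k] by (simp add: power2_eq_square)
  then have "real (Suc k) * ((fact k)\<^sup>2 / fact (2 * k)) * ((2 * L) ^ (2 * k) * (1 / (8 * L\<^sup>2)) ^ k)
      \<le> real (Suc k) * 1 * ((2 * L) ^ (2 * k) * (1 / (8 * L\<^sup>2)) ^ k)"
    using L_pos by (intro mult_right_mono mult_left_mono) auto
  then have le: "real (Suc k) * ((fact k)\<^sup>2 / fact (2 * k)) * ((2 * L) ^ (2 * k) * (1 / (8 * L\<^sup>2)) ^ k)
      \<le> real (Suc k) * (1 / 2) ^ k"
    by (simp only: mult_1_right half)
  have eq: "weight k * ((fact k)\<^sup>2 * K ^ k)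
      = real (Suc k) * ((fact k)\<^sup>2 / fact (2 * k)) * ((2 * L) ^ (2 * k) * K ^ k)" for K
    by (simp only: weight_def times_divide_eq_left times_divide_eq_right mult_ac)
  show ?thesis
    unfolding eq by (rule le)
qed

lemma weight_bump_le:
  assumes "j \<le> 1"
  shows "weight k * \<bar>g (k + j) t\<bar> \<le> majorant k"
proof -
  define K where "K = 1 / (8 * L\<^sup>2)"
  have K: "0 < K"
    using L_pos by (simp add: K_def)
  have le: "weight k * ((fact k)\<^sup>2 * K ^ k) \<le> real (Suc k) * (1 / 2) ^ k"
    unfolding K_def by (rule weight_mult_bound)
  have one: "1 \<le> real (Suc k) ^ 2"
    by simp
  consider "j = 0" | "j = 1"
    using assms by linarith
  then show ?thesis
  proof cases
    case 1
    have "weight k * \<bar>g (k + j) t\<bar> \<le> weight k * ((fact k)\<^sup>2 * K ^ k)"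
      using 1 bump_bound weight_nonneg by (simp add: K_def mult_left_mono)
    also have "\<dots> \<le> real (Suc k) * (1 / 2) ^ k"
      by (rule le)
    also have "\<dots> = 1 * 1 * (real (Suc k) * (1 / 2) ^ k)"
      by simp
    also have "\<dots> \<le> (1 + K) * real (Suc k) ^ 2 * (real (Suc k) * (1 / 2) ^ k)"
      using K one by (intro mult_mono) auto
    also have "\<dots> = majorant k"
      by (simp add: majorant_def K_def power3_eq_cube power2_eq_square algebra_simps)
    finally show ?thesis .
  next
    case 2
    have "weight k * \<bar>g (k + j) t\<bar> \<le> weight k * ((fact (Suc k))\<^sup>2 * K ^ Suc k)"
      using mult_left_mono[OF bump_bound[of "Suc k" t] weight_nonneg[of k]] 2
      unfolding K_def by (simp only: add_Suc_right One_nat_def add_0_right)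
    also have "\<dots> = K * real (Suc k) ^ 2 * (weight k * ((fact k)\<^sup>2 * K ^ k))"
      by (simp only: fact_Suc power_mult_distrib power_Suc mult_ac of_nat_mult)
    also have "\<dots> \<le> (1 + K) * real (Suc k) ^ 2 * (real (Suc k) * (1 / 2) ^ k)"
      using K by (intro mult_mono le) (auto simp: weight_nonneg)
    also have "\<dots> = majorant k"
      by (simp add: majorant_def K_def power3_eq_cube power2_eq_square algebra_simps)
    finally show ?thesis .
  qed
qed

text \<open>The estimates of the profiles come out with index k + 1; shifting the index back costs
  only a constant.\<close>

lemma weight_Suc_le: "weight (Suc k) \<le> 4 * L\<^sup>2 * weight k"
proof -
  have f: "fact (2 * Suc k) = (real (2 * k + 2) * real (2 * k + 1)) * fact (2 * k)"
    by (simp add: algebra_simps)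
  have "real (Suc (Suc k)) \<le> real (Suc k) * (real (2 * k + 2) * real (2 * k + 1))"
    by (simp add: algebra_simps)
  then have "real (Suc (Suc k)) / (real (2 * k + 2) * real (2 * k + 1)) \<le> real (Suc k)"
    by (subst divide_le_eq) auto
  then have "real (Suc (Suc k)) / (real (2 * k + 2) * real (2 * k + 1)) * ((2 * L) ^ (2 * Suc k) / fact (2 * k))
      \<le> real (Suc k) * ((2 * L) ^ (2 * Suc k) / fact (2 * k))"
    using L_pos by (intro mult_right_mono) auto
  moreover have "weight (Suc k)
      = real (Suc (Suc k)) / (real (2 * k + 2) * real (2 * k + 1)) * ((2 * L) ^ (2 * Suc k) / fact (2 * k))"
    unfolding weight_def f by (simp only: divide_divide_eq_left times_divide_eq_left times_divide_eq_right mult_ac)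
  moreover have "real (Suc k) * ((2 * L) ^ (2 * Suc k) / fact (2 * k)) = 4 * L\<^sup>2 * weight k"
    by (simp add: weight_def power2_eq_square)
  ultimately show ?thesis
    by simp
qed

text \<open>The form of \<open>weight\<close> fits Cauchy products: its factor k + 1 counts their
  summands, and the base 2 * L instead of L pays for the binomial coefficients in
  \<open>divided_power_mult_le\<close>.\<close>

definition dominated :: "'b set \<Rightarrow> (nat \<Rightarrow> 'b \<Rightarrow> real) \<Rightarrow> bool" where
  "dominated S \<alpha> \<longleftrightarrow> (\<exists>C. \<forall>k. \<forall>x\<in>S. \<bar>\<alpha> k x\<bar> \<le> C * weight k)"

text \<open>Only j = 0 and j = 1 will occur: the heat equation is of first order in t, and space
  derivatives act on the coefficients \<alpha> alone.\<close>

definition bump_series :: "(nat \<Rightarrow> 'b \<Rightarrow> real) \<Rightarrow> nat \<Rightarrow> 'b \<Rightarrow> real \<Rightarrow> real" where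
  "bump_series \<alpha> j x t = (\<Sum>k. \<alpha> k x * g (k + j) t)"

lemma dominated_term_bound:
  assumes "dominated S \<alpha>" and "j \<le> 1"
  obtains C where "\<And>k x t. x \<in> S \<Longrightarrow> norm (\<alpha> k x * g (k + j) t) \<le> C * majorant k"
    "summable (\<lambda>k. C * majorant k)"
proof -
  obtain C where C: "\<And>k x. x \<in> S \<Longrightarrow> \<bar>\<alpha> k x\<bar> \<le> C * weight k"
    using assms(1) by (auto simp: dominated_def)
  show thesis
  proof
    fix k x t assume x: "x \<in> S"
    have "norm (\<alpha> k x * g (k + j) t) \<le> \<bar>C\<bar> * weight k * \<bar>g (k + j) t\<bar>"
      unfolding real_norm_def abs_mult
    proof (rule mult_right_mono)
      show "\<bar>\<alpha> k x\<bar> \<le> \<bar>C\<bar> * weight k"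
        using C[OF x, of k] mult_right_mono[OF abs_ge_self weight_nonneg, of C k] by linarith
    qed simp
    also have "\<dots> \<le> \<bar>C\<bar> * majorant k"
      using weight_bump_le[OF assms(2)] by (simp add: mult.assoc mult_left_mono)
    finally show "norm (\<alpha> k x * g (k + j) t) \<le> \<bar>C\<bar> * majorant k" .
  qed (intro summable_mult summable_majorant)
qed

text \<open>Uniformity in x and t jointly yields the joint continuity that \<open>C21_on\<close>
  demands; restricted to one variable it justifies termwise differentiation.\<close>

lemma bump_series_uniform_limit:
  assumes "dominated S \<alpha>" and "j \<le> 1"
  shows "uniform_limit (S \<times> UNIV) (\<lambda>n (x, t). \<Sum>k<n. \<alpha> k x * g (k + j) t)
    (\<lambda>(x, t). bump_series \<alpha> j x t) sequentially"
proof -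
  obtain C where "\<And>k x t. x \<in> S \<Longrightarrow> norm (\<alpha> k x * g (k + j) t) \<le> C * majorant k"
    "summable (\<lambda>k. C * majorant k)"
    using dominated_term_bound[OF assms] by blast
  then have "uniform_limit (S \<times> UNIV) (\<lambda>n z. \<Sum>k<n. \<alpha> k (fst z) * g (k + j) (snd z))
      (\<lambda>z. \<Sum>k. \<alpha> k (fst z) * g (k + j) (snd z)) sequentially"
    by (intro Weierstrass_m_test[where M = "\<lambda>k. C * majorant k"]) auto
  then show ?thesis
    by (simp add: bump_series_def case_prod_beta')
qed

lemma bump_series_summable:
  assumes "dominated S \<alpha>" and "j \<le> 1" and "x \<in> S"
  shows "summable (\<lambda>k. \<alpha> k x * g (k + j) t)"
proof -
  obtain C where C: "\<And>k x t. x \<in> S \<Longrightarrow> norm (\<alpha> k x * g (k + j) t) \<le> C * majorant k"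
    "summable (\<lambda>k. C * majorant k)"
    using dominated_term_bound[OF assms(1,2)] by blast
  show ?thesis
    by (rule summable_comparison_test'[OF C(2), of 0]) (rule C(1)[OF assms(3)])
qed

lemma bump_series_continuous:
  assumes "dominated S \<alpha>" and "j \<le> 1" and "\<And>k. continuous_on S (\<alpha> k)"
  shows "continuous_on (S \<times> UNIV) (\<lambda>(x, t). bump_series \<alpha> j x t)"
proof (rule uniform_limit_theorem[OF _ bump_series_uniform_limit[OF assms(1,2)]])
  have "continuous_on (S \<times> UNIV) (\<lambda>z. \<alpha> k (fst z))" for k
    by (rule continuous_on_compose2[OF assms(3)]) (auto intro!: continuous_intros)
  then show "\<forall>\<^sub>F n in sequentially. continuous_on (S \<times> UNIV) (\<lambda>(x, t). \<Sum>k<n. \<alpha> k x * g (k + j) t)"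
    unfolding case_prod_beta' by (intro always_eventually allI continuous_intros)
qed simp

lemma bump_series_deriv_time:
  assumes "dominated S \<alpha>" and "x \<in> S"
  shows "((\<lambda>t. bump_series \<alpha> 0 x t) has_real_derivative bump_series \<alpha> 1 x t) (at t)"
proof -
  have lim: "uniform_limit ({x} \<times> UNIV) (\<lambda>n (x, t). \<Sum>k<n. \<alpha> k x * g (k + 1) t)
      (\<lambda>(x, t). bump_series \<alpha> 1 x t) sequentially"
    using bump_series_uniform_limit[OF assms(1), of 1] assms(2) by (auto elim: uniform_limit_on_subset)
  have "((\<lambda>t. \<Sum>k. \<alpha> k x * g (k + 0) t) has_real_derivative (\<Sum>k. \<alpha> k x * g (k + 1) t)) (at t)"
  proof (rule has_field_derivative_series'(2)[where S = UNIV and ?x0.0 = t])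
    show "((\<lambda>t. \<alpha> k x * g (k + 0) t) has_real_derivative \<alpha> k x * g (k + 1) t) (at t within UNIV)" for k t
      using DERIV_cmult[OF bump_deriv[of k t], of "\<alpha> k x"] by simp
    show "uniformly_convergent_on UNIV (\<lambda>n t. \<Sum>k<n. \<alpha> k x * g (k + 1) t)"
      unfolding uniformly_convergent_on_def
      using lim by (intro exI[of _ "bump_series \<alpha> 1 x"]) (auto simp: uniform_limit_iff)
    show "summable (\<lambda>k. \<alpha> k x * g (k + 0) t)"
      by (rule bump_series_summable[OF assms(1) _ assms(2)]) simp
  qed auto
  then show ?thesis
    by (simp add: bump_series_def)
qed

text \<open>The coefficients are differentiable only within the closed interval; at an interior
  point the derivative of the sum becomes two-sided.\<close>

lemma bump_series_deriv_space:
  fixes \<alpha> \<beta> :: "nat \<Rightarrow> real \<Rightarrow> real"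
  assumes "dominated S \<alpha>" and "dominated S \<beta>" and "convex S" and x: "x \<in> interior S"
    and "\<And>k x. x \<in> S \<Longrightarrow> (\<alpha> k has_real_derivative \<beta> k x) (at x within S)"
  shows "((\<lambda>x. bump_series \<alpha> 0 x t) has_real_derivative bump_series \<beta> 0 x t) (at x)"
proof -
  have lim: "uniform_limit (S \<times> {t}) (\<lambda>n (x, t). \<Sum>k<n. \<beta> k x * g (k + 0) t)
      (\<lambda>(x, t). bump_series \<beta> 0 x t) sequentially"
  proof (rule uniform_limit_on_subset)
    show "uniform_limit (S \<times> UNIV) (\<lambda>n (x, t). \<Sum>k<n. \<beta> k x * g (k + 0) t)
        (\<lambda>(x, t). bump_series \<beta> 0 x t) sequentially"
      using assms(2) by (intro bump_series_uniform_limit) auto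
  qed auto
  have "((\<lambda>x. \<Sum>k. \<alpha> k x * g (k + 0) t) has_real_derivative (\<Sum>k. \<beta> k x * g (k + 0) t)) (at x)"
  proof (rule has_field_derivative_series'(2)[where S = S and ?x0.0 = x])
    show "((\<lambda>x. \<alpha> k x * g (k + 0) t) has_real_derivative \<beta> k x * g (k + 0) t) (at x within S)"
      if "x \<in> S" for k x
      using assms(5)[OF that] by (rule DERIV_cmult_right)
    show "uniformly_convergent_on S (\<lambda>n x. \<Sum>k<n. \<beta> k x * g (k + 0) t)"
      unfolding uniformly_convergent_on_def
      using lim by (intro exI[of _ "\<lambda>x. bump_series \<beta> 0 x t"]) (simp add: uniform_limit_iff)
    show "x \<in> S"
      using x interior_subset by blast
    then show "summable (\<lambda>k. \<alpha> k x * g (k + 0) t)"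
      by (intro bump_series_summable[OF assms(1)]) auto
  qed (use assms in auto)
  then show ?thesis
    by (simp add: bump_series_def)
qed

lemma bump_series_zero:
  assumes "t \<le> 0 \<or> T \<le> t"
  shows "bump_series \<alpha> j x t = 0"
  using bump_zero[OF assms] by (simp add: bump_series_def)

end

section \<open>A source and a solution of the heat equation vanishing after time T\<close>

text \<open>By Cauchy's formula for repeated integration, index 2j + 2 is the coefficient of z^j in
  \<integral> S(x - y, z) F(y) dy over [0, x]. The recursive form makes differentiation in x a mere
  decrease of the index.\<close>

primrec iterated_integral :: "(real \<Rightarrow> real) \<Rightarrow> nat \<Rightarrow> real \<Rightarrow> real" where
  "iterated_integral F 0 x = F x"
| "iterated_integral F (Suc m) x = integral {0..x} (iterated_integral F m)"

lemma iterated_integral_continuous_on: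
  assumes "continuous_on {0..L} F"
  shows "continuous_on {0..L} (iterated_integral F m)"
proof (induction m)
  case 0
  have "iterated_integral F 0 = F"
    by (simp add: fun_eq_iff)
  with assms show ?case
    by simp
next
  case (Suc m)
  have "iterated_integral F (Suc m) = (\<lambda>x. integral {0..x} (iterated_integral F m))"
    by (simp add: fun_eq_iff)
  with Suc show ?case
    by (simp add: indefinite_integral_continuous_1 integrable_continuous_interval)
qed

lemma iterated_integral_deriv:
  assumes "continuous_on {0..L} F" and "x \<in> {0..L}"
  shows "(iterated_integral F (Suc m) has_real_derivative iterated_integral F m x) (at x within {0..L})"
proof -
  have "iterated_integral F (Suc m) = (\<lambda>x. integral {0..x} (iterated_integral F m))"
    by (simp add: fun_eq_iff)
  then show ?thesis
    using integral_has_real_derivative[OF iterated_integral_continuous_on assms(2)] assms(1) by simp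
qed

lemma iterated_integral_bound:
  assumes "continuous_on {0..L} F" and "\<And>x. x \<in> {0..L} \<Longrightarrow> \<bar>F x\<bar> \<le> B" and "x \<in> {0..L}"
  shows "\<bar>iterated_integral F m x\<bar> \<le> B * (x ^ m / fact m)"
  using assms(3)
proof (induction m arbitrary: x)
  case 0
  then show ?case
    using assms(2) by simp
next
  case (Suc m)
  have deriv: "((\<lambda>y. B * (y ^ Suc m / fact (Suc m))) has_real_derivative B * (y ^ m / fact m)) (at y within S)"
    for y S
    by (auto intro!: derivative_eq_intros simp: divide_simps simp del: power_Suc of_nat_Suc)
  have int: "((\<lambda>y. B * (y ^ m / fact m)) has_integral
      B * (x ^ Suc m / fact (Suc m)) - B * (0 ^ Suc m / fact (Suc m))) {0..x}"
    using Suc.prems deriv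
    by (intro fundamental_theorem_of_calculus) (auto simp flip: has_real_derivative_iff_has_vector_derivative)
  have "norm (integral {0..x} (iterated_integral F m)) \<le> integral {0..x} (\<lambda>y. B * (y ^ m / fact m))"
  proof (rule integral_norm_bound_integral)
    show "iterated_integral F m integrable_on {0..x}"
      using Suc.prems
      by (intro integrable_continuous_interval continuous_on_subset[OF iterated_integral_continuous_on[OF assms(1)]]) auto
    show "(\<lambda>y. B * (y ^ m / fact m)) integrable_on {0..x}"
      using int by (rule has_integral_integrable)
    show "norm (iterated_integral F m y) \<le> B * (y ^ m / fact m)" if "y \<in> {0..x}" for y
      using Suc.IH[of y] Suc.prems that by simp
  qed
  then show ?case
    using integral_unique[OF int] by simp
qed

text \<open>The product is a binomial coefficient times L^(p+q) / (p+q)!, and that coefficient is at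
  most 2^(p+q).\<close>

lemma divided_power_mult_le:
  fixes L :: real
  assumes "0 \<le> L"
  shows "L ^ p / fact p * (L ^ q / fact q) \<le> (2 * L) ^ (p + q) / fact (p + q)"
proof -
  have "real (p + q choose p) \<le> real (2 ^ (p + q))"
    by (intro of_nat_mono binomial_le_pow2)
  then have le: "real (p + q choose p) \<le> 2 ^ (p + q)"
    by simp
  have "L ^ p / fact p * (L ^ q / fact q) = L ^ (p + q) / fact (p + q) * real (p + q choose p)"
    by (simp add: binomial_fact power_add)
  also have "\<dots> \<le> L ^ (p + q) / fact (p + q) * 2 ^ (p + q)"
    using assms le by (intro mult_left_mono) auto
  finally show ?thesis
    by (simp add: power_mult_distrib mult.commute)
qed

locale flat_heat_source = gevrey_bump +
  fixes F :: "real \<Rightarrow> real"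
  assumes F_cont: "continuous_on {0..L} F"
begin

section \<open>Taylor coefficients in z of the source and of the temperature\<close>

abbreviation H :: "nat \<Rightarrow> real \<Rightarrow> real" where
  "H \<equiv> iterated_integral F"

definition sinh_coeff :: "nat \<Rightarrow> real" where
  "sinh_coeff k = L ^ (2 * k + 1) / fact (2 * k + 1)"

text \<open>A difference of two Cauchy products, with index i from S and k - i from the integral.
  Exchanging x and L changes its sign, hence the zero at L; at 0 every summand vanishes.\<close>

definition profile :: "nat \<Rightarrow> real \<Rightarrow> real" where
  "profile k x = (\<Sum>i\<le>k. x ^ (2 * i + 1) / fact (2 * i + 1) * H (2 * (k - i) + 2) L
                       - L ^ (2 * i + 1) / fact (2 * i + 1) * H (2 * (k - i) + 2) x)"

definition profile' :: "nat \<Rightarrow> real \<Rightarrow> real" where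
  "profile' k x = (\<Sum>i\<le>k. x ^ (2 * i) / fact (2 * i) * H (2 * (k - i) + 2) L
                        - L ^ (2 * i + 1) / fact (2 * i + 1) * H (2 * (k - i) + 1) x)"

text \<open>The coefficient of z^k in u'' = z u - S(L, z) F; multiplication by z is the shift to
  \<open>profile (k - 1)\<close>.\<close>

definition profile'' :: "nat \<Rightarrow> real \<Rightarrow> real" where
  "profile'' k x = (if k = 0 then 0 else profile (k - 1) x) - sinh_coeff k * F x"

text \<open>The coefficients get a dummy space variable, evaluated at 0, so that the results on
  \<open>bump_series\<close> cover functions of time alone.\<close>

definition source :: "real \<Rightarrow> real" where
  "source = bump_series (\<lambda>k _ :: real. sinh_coeff k) 0 0"

definition source' :: "real \<Rightarrow> real" where
  "source' = bump_series (\<lambda>k _ :: real. sinh_coeff k) 1 0"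

definition temperature :: "real \<Rightarrow> real \<Rightarrow> real" where
  "temperature = bump_series profile 0"

lemma profile_0: "profile k 0 = 0"
  by (simp add: profile_def)

lemma profile_L: "profile k L = 0"
  by (simp add: profile_def)

lemma divided_power_deriv:
  "((\<lambda>x. x ^ Suc n / fact (Suc n)) has_real_derivative x ^ n / fact n) (at x within S)"
  by (auto intro!: derivative_eq_intros simp: divide_simps simp del: power_Suc of_nat_Suc)

lemma profile_deriv:
  assumes "x \<in> {0..L}"
  shows "(profile k has_real_derivative profile' k x) (at x within {0..L})"
proof -
  have "((\<lambda>x. x ^ (2 * i + 1) / fact (2 * i + 1)) has_real_derivative x ^ (2 * i) / fact (2 * i)) (at x within {0..L})" for i
    using divided_power_deriv[of "2 * i"] by simp
  moreover have "(H (2 * (k - i) + 2) has_real_derivative H (2 * (k - i) + 1) x) (at x within {0..L})" for i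
  proof -
    have "2 * (k - i) + 2 = Suc (2 * (k - i) + 1)"
      by simp
    then show ?thesis
      using iterated_integral_deriv[OF F_cont assms] by metis
  qed
  ultimately have "((\<lambda>x. \<Sum>i\<le>k. x ^ (2 * i + 1) / fact (2 * i + 1) * H (2 * (k - i) + 2) L
      - L ^ (2 * i + 1) / fact (2 * i + 1) * H (2 * (k - i) + 2) x) has_real_derivative profile' k x) (at x within {0..L})"
    unfolding profile'_def by (intro DERIV_sum DERIV_diff DERIV_cmult_right DERIV_cmult)
  then show ?thesis
    by (simp only: profile_def[abs_def])
qed

lemma profile'_deriv:
  assumes x: "x \<in> {0..L}"
  shows "(profile' k has_real_derivative profile'' k x) (at x within {0..L})"
proof -
  have H: "(H (Suc n) has_real_derivative H n x) (at x within {0..L})" for n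
    by (rule iterated_integral_deriv[OF F_cont x])
  \<comment> \<open>The summand i = 0 is constant in x, whereas truncated subtraction would give 2 *
    0 - 1 = 0 and hence the value 1.\<close>
  define d where "d = (\<lambda>i. if i = 0 then 0 else x ^ (2 * i - 1) / fact (2 * i - 1))"
  have "((\<lambda>x. x ^ (2 * i) / fact (2 * i)) has_real_derivative d i) (at x within {0..L})" for i
  proof (cases i)
    case 0
    then show ?thesis by (simp add: d_def)
  next
    case (Suc n)
    then show ?thesis
      using divided_power_deriv[of "2 * n + 1"] by (simp add: d_def)
  qed
  moreover have "(H (2 * (k - i) + 1) has_real_derivative H (2 * (k - i)) x) (at x within {0..L})" for i
    using H[of "2 * (k - i)"] by simp
  ultimately have "((\<lambda>x. \<Sum>i\<le>k. x ^ (2 * i) / fact (2 * i) * H (2 * (k - i) + 2) L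
      - L ^ (2 * i + 1) / fact (2 * i + 1) * H (2 * (k - i) + 1) x) has_real_derivative
      (\<Sum>i\<le>k. d i * H (2 * (k - i) + 2) L - L ^ (2 * i + 1) / fact (2 * i + 1) * H (2 * (k - i)) x))
      (at x within {0..L})"
    by (intro DERIV_sum DERIV_diff DERIV_cmult_right DERIV_cmult)
  moreover have "(\<Sum>i\<le>k. d i * H (2 * (k - i) + 2) L - L ^ (2 * i + 1) / fact (2 * i + 1) * H (2 * (k - i)) x)
      = profile'' k x"
  proof (cases k)
    case 0
    then show ?thesis
      by (simp add: d_def profile''_def sinh_coeff_def)
  next
    case (Suc n)
    \<comment> \<open>Dropping the zero summand and shifting i gives the first half of
      \<open>profile n\<close>. In the other sum the last summand contains H 0 = F and splits off as
      the source term.\<close>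
    have "(\<Sum>i\<le>Suc n. d i * H (2 * (Suc n - i) + 2) L)
        = (\<Sum>i\<le>n. x ^ (2 * i + 1) / fact (2 * i + 1) * H (2 * (n - i) + 2) L)"
      by (subst sum.atMost_Suc_shift) (simp add: d_def)
    moreover have "(\<Sum>i\<le>Suc n. L ^ (2 * i + 1) / fact (2 * i + 1) * H (2 * (Suc n - i)) x)
        = (\<Sum>i\<le>n. L ^ (2 * i + 1) / fact (2 * i + 1) * H (2 * (n - i) + 2) x) + sinh_coeff (Suc n) * F x"
      by (subst sum.atMost_Suc) (simp add: sinh_coeff_def Suc_diff_le del: iterated_integral.simps(2))
    ultimately show ?thesis
      unfolding Suc by (simp add: profile''_def profile_def sum_subtractf del: iterated_integral.simps(2))
  qed
  ultimately show ?thesis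
    by (simp only: profile'_def[abs_def])
qed

section \<open>Growth of the coefficients\<close>

lemma F_bounded:
  obtains B where "0 \<le> B" "\<forall>x\<in>{0..L}. \<bar>F x\<bar> \<le> B"
proof -
  have "bounded (F ` {0..L})"
    using F_cont by (simp add: compact_continuous_image compact_imp_bounded)
  then obtain B where "0 < B" "\<forall>y\<in>F ` {0..L}. norm y \<le> B"
    unfolding bounded_pos by blast
  then show thesis
    using that[of B] by simp
qed

lemma product_term_bound:
  assumes "\<forall>x\<in>{0..L}. \<bar>F x\<bar> \<le> B" and "0 \<le> B" and x: "x \<in> {0..L}" and y: "y \<in> {0..L}"
  shows "\<bar>x ^ p / fact p * H q y\<bar> \<le> B * ((2 * L) ^ (p + q) / fact (p + q))"
proof -
  have "\<bar>H q y\<bar> \<le> B * (y ^ q / fact q)"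
    using assms(1) by (intro iterated_integral_bound[OF F_cont _ y]) auto
  also have "\<dots> \<le> B * (L ^ q / fact q)"
    using assms by (intro mult_left_mono divide_right_mono power_mono) auto
  finally have "\<bar>x ^ p / fact p\<bar> * \<bar>H q y\<bar> \<le> L ^ p / fact p * (B * (L ^ q / fact q))"
    using x L_pos by (intro mult_mono) (auto intro!: divide_right_mono power_mono)
  also have "\<dots> = B * (L ^ p / fact p * (L ^ q / fact q))"
    by simp
  also have "\<dots> \<le> B * ((2 * L) ^ (p + q) / fact (p + q))"
    using assms L_pos by (intro mult_left_mono divided_power_mult_le) auto
  finally show ?thesis
    by (simp only: abs_mult)
qed

text \<open>The summands of \<open>profile k\<close> have total degree 2k + 3, those of
  \<open>profile' k\<close> degree 2k + 2; this brings both to the degree of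
  \<open>weight (Suc k)\<close>.\<close>

lemma Suc_divided_power_le:
  "(2 * L) ^ (2 * k + 3) / fact (2 * k + 3) \<le> 2 * L * ((2 * L) ^ (2 * k + 2) / fact (2 * k + 2))"
proof -
  have "fact (2 * k + 2) \<le> (fact (2 * k + 3) :: real)"
    by (rule fact_mono) simp
  then have "(2 * L) ^ (2 * k + 3) / fact (2 * k + 3) \<le> (2 * L) ^ (2 * k + 3) / fact (2 * k + 2)"
    using L_pos by (intro divide_left_mono) auto
  also have "\<dots> = 2 * L * ((2 * L) ^ (2 * k + 2) / fact (2 * k + 2))"
    by (simp add: eval_nat_numeral)
  finally show ?thesis .
qed

lemma convolution_le_weight:
  "real (Suc k) * ((2 * L) ^ (2 * k + 2) / fact (2 * k + 2)) \<le> weight (Suc k)"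
proof -
  have "real (Suc k) * ((2 * L) ^ (2 * k + 2) / fact (2 * k + 2))
      \<le> real (Suc (Suc k)) * ((2 * L) ^ (2 * k + 2) / fact (2 * k + 2))"
    using L_pos by (intro mult_right_mono) auto
  then show ?thesis
    by (simp add: weight_def)
qed

lemma profile_bounds:
  "\<exists>C\<ge>0. \<forall>k. \<forall>x\<in>{0..L}. \<bar>profile k x\<bar> \<le> C * weight (Suc k) \<and> \<bar>profile' k x\<bar> \<le> C * weight (Suc k)"
proof -
  obtain B where B: "0 \<le> B" "\<forall>x\<in>{0..L}. \<bar>F x\<bar> \<le> B"
    by (rule F_bounded)
  define q where "q = (\<lambda>n. (2 * L) ^ n / fact n)"
  note term_bound = product_term_bound[OF B(2,1), folded q_def]
  \<comment> \<open>The 2 stands for the two products in each summand; 1 + 2 * L covers degree 2k +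
    2 (factor 1) and degree 2k + 3 (factor 2 * L).\<close>
  define C where "C = B * (2 * (1 + 2 * L))"
  have C: "0 \<le> C"
    using B L_pos by (simp add: C_def)
  have q: "0 \<le> q n" for n
    using L_pos by (simp add: q_def)
  have L: "L \<in> {0..L}"
    using L_pos by simp
  have bound: "\<bar>\<Sum>i\<le>k. h i\<bar> \<le> C * weight (Suc k)"
    if "\<And>i. i \<le> k \<Longrightarrow> \<bar>h i\<bar> \<le> C * q (2 * k + 2)" for h k
  proof -
    have "\<bar>\<Sum>i\<le>k. h i\<bar> \<le> (\<Sum>i\<le>k. \<bar>h i\<bar>)"
      by (rule sum_abs)
    also have "\<dots> \<le> (\<Sum>i\<le>k. C * q (2 * k + 2))"
      using that by (intro sum_mono) auto
    also have "\<dots> = C * (real (Suc k) * q (2 * k + 2))"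
      by simp
    also have "\<dots> \<le> C * weight (Suc k)"
      unfolding q_def by (intro mult_left_mono convolution_le_weight C)
    finally show ?thesis .
  qed
  have q3: "q (2 * k + 3) \<le> 2 * L * q (2 * k + 2)" for k
    unfolding q_def by (rule Suc_divided_power_le)
  have le: "B * q (2 * k + 3) \<le> B * (2 * L * q (2 * k + 2))" for k
    using B q3 by (intro mult_left_mono) auto
  have nonneg: "0 \<le> B * q n" "0 \<le> B * (L * q n)" for n
    using B q L_pos by auto
  show ?thesis
  proof (intro exI[of _ C] conjI C allI ballI)
    fix k and x assume x: "x \<in> {0..L}"
    show "\<bar>profile k x\<bar> \<le> C * weight (Suc k)"
      unfolding profile_def
    proof (rule bound)
      fix i assume "i \<le> k"
      then have "2 * i + 1 + (2 * (k - i) + 2) = 2 * k + 3"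
        by simp
      then have "\<bar>x ^ (2 * i + 1) / fact (2 * i + 1) * H (2 * (k - i) + 2) L\<bar> \<le> B * q (2 * k + 3)"
          "\<bar>L ^ (2 * i + 1) / fact (2 * i + 1) * H (2 * (k - i) + 2) x\<bar> \<le> B * q (2 * k + 3)"
        using term_bound[OF x L, of "2 * i + 1" "2 * (k - i) + 2"]
          term_bound[OF L x, of "2 * i + 1" "2 * (k - i) + 2"] by (simp_all only: q_def)
      then have "\<bar>x ^ (2 * i + 1) / fact (2 * i + 1) * H (2 * (k - i) + 2) L
          - L ^ (2 * i + 1) / fact (2 * i + 1) * H (2 * (k - i) + 2) x\<bar> \<le> 2 * (B * q (2 * k + 3))"
        by linarith
      also have "\<dots> \<le> C * q (2 * k + 2)"
        using le[of k] nonneg[of "2 * k + 2"] by (simp add: C_def algebra_simps)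
      finally show "\<bar>x ^ (2 * i + 1) / fact (2 * i + 1) * H (2 * (k - i) + 2) L
          - L ^ (2 * i + 1) / fact (2 * i + 1) * H (2 * (k - i) + 2) x\<bar> \<le> C * q (2 * k + 2)" .
    qed
    show "\<bar>profile' k x\<bar> \<le> C * weight (Suc k)"
      unfolding profile'_def
    proof (rule bound)
      fix i assume "i \<le> k"
      then have "2 * i + (2 * (k - i) + 2) = 2 * k + 2" "2 * i + 1 + (2 * (k - i) + 1) = 2 * k + 2"
        by auto
      then have "\<bar>x ^ (2 * i) / fact (2 * i) * H (2 * (k - i) + 2) L\<bar> \<le> B * q (2 * k + 2)"
          "\<bar>L ^ (2 * i + 1) / fact (2 * i + 1) * H (2 * (k - i) + 1) x\<bar> \<le> B * q (2 * k + 2)"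
        using term_bound[OF x L, of "2 * i" "2 * (k - i) + 2"]
          term_bound[OF L x, of "2 * i + 1" "2 * (k - i) + 1"] by (simp_all only: q_def)
      then have "\<bar>x ^ (2 * i) / fact (2 * i) * H (2 * (k - i) + 2) L
          - L ^ (2 * i + 1) / fact (2 * i + 1) * H (2 * (k - i) + 1) x\<bar> \<le> 2 * (B * q (2 * k + 2))"
        by linarith
      also have "\<dots> \<le> C * q (2 * k + 2)"
        using nonneg[of "2 * k + 2"] by (simp add: C_def algebra_simps)
      finally show "\<bar>x ^ (2 * i) / fact (2 * i) * H (2 * (k - i) + 2) L
          - L ^ (2 * i + 1) / fact (2 * i + 1) * H (2 * (k - i) + 1) x\<bar> \<le> C * q (2 * k + 2)" .
    qed
  qed
qed

lemma sinh_coeff_bound: "0 \<le> sinh_coeff k \<and> sinh_coeff k \<le> L * weight k"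
proof -
  have "L ^ (2 * k) \<le> (2 * L) ^ (2 * k)"
    using L_pos by (intro power_mono) auto
  moreover have "fact (2 * k) \<le> (fact (2 * k + 1) :: real)"
    by (rule fact_mono) simp
  ultimately have "L ^ (2 * k) / fact (2 * k + 1) \<le> (2 * L) ^ (2 * k) / fact (2 * k)"
    using L_pos by (intro frac_le) auto
  also have "\<dots> = 1 * ((2 * L) ^ (2 * k) / fact (2 * k))"
    by simp
  also have "\<dots> \<le> real (Suc k) * ((2 * L) ^ (2 * k) / fact (2 * k))"
    using L_pos by (intro mult_right_mono) auto
  finally have "L * (L ^ (2 * k) / fact (2 * k + 1)) \<le> L * weight k"
    using L_pos by (intro mult_left_mono) (auto simp: weight_def)
  then show ?thesis
    using L_pos by (simp add: sinh_coeff_def)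
qed

lemma dominated_of_Suc:
  assumes "0 \<le> C" and "\<And>k x. x \<in> S \<Longrightarrow> \<bar>\<alpha> k x\<bar> \<le> C * weight (Suc k)"
  shows "dominated S \<alpha>"
  unfolding dominated_def
proof (intro exI[of _ "C * (4 * L\<^sup>2)"] allI ballI)
  fix k x assume "x \<in> S"
  then have "\<bar>\<alpha> k x\<bar> \<le> C * weight (Suc k)"
    by (rule assms(2))
  also have "\<dots> \<le> C * (4 * L\<^sup>2 * weight k)"
    by (intro mult_left_mono weight_Suc_le assms(1))
  finally show "\<bar>\<alpha> k x\<bar> \<le> C * (4 * L\<^sup>2) * weight k"
    by (simp only: mult.assoc)
qed

lemma dominated_sinh_coeff: "dominated S (\<lambda>k _ :: real. sinh_coeff k)"
  unfolding dominated_def by (intro exI[of _ L]) (simp add: sinh_coeff_bound)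

lemma dominated_sinh_coeff_Suc: "dominated S (\<lambda>k _ :: real. sinh_coeff (Suc k))"
  using L_pos by (intro dominated_of_Suc[of L]) (simp_all add: sinh_coeff_bound)

lemma dominated_profile: "dominated {0..L} profile"
proof -
  obtain C where C: "0 \<le> C" "\<And>k x. x \<in> {0..L} \<Longrightarrow> \<bar>profile k x\<bar> \<le> C * weight (Suc k)"
    using profile_bounds by blast
  then show ?thesis
    by (rule dominated_of_Suc)
qed

lemma dominated_profile': "dominated {0..L} profile'"
proof -
  obtain C where C: "0 \<le> C" "\<And>k x. x \<in> {0..L} \<Longrightarrow> \<bar>profile' k x\<bar> \<le> C * weight (Suc k)"
    using profile_bounds by blast
  then show ?thesis
    by (rule dominated_of_Suc)
qed

lemma dominated_profile'': "dominated {0..L} profile''"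
proof -
  obtain C where C: "0 \<le> C" "\<And>k x. x \<in> {0..L} \<Longrightarrow> \<bar>profile k x\<bar> \<le> C * weight (Suc k)"
    using profile_bounds by blast
  obtain B where B: "0 \<le> B" "\<forall>x\<in>{0..L}. \<bar>F x\<bar> \<le> B"
    by (rule F_bounded)
  show ?thesis
    unfolding dominated_def
  proof (intro exI[of _ "C + L * B"] allI ballI)
    fix k x assume x: "x \<in> {0..L}"
    \<comment> \<open>For k > 0 the bound of \<open>profile (k - 1)\<close> has exactly the weight
      of index k, so the shift loses nothing.\<close>
    have "\<bar>if k = 0 then 0 else profile (k - 1) x\<bar> \<le> C * weight k"
      using C(1) C(2)[OF x, of "k - 1"] weight_nonneg[of k] by auto
    moreover have "\<bar>sinh_coeff k * F x\<bar> \<le> L * weight k * B"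
      unfolding abs_mult using sinh_coeff_bound[of k] B(2) x L_pos weight_nonneg[of k]
      by (intro mult_mono) auto
    ultimately show "\<bar>profile'' k x\<bar> \<le> (C + L * B) * weight k"
      unfolding profile''_def by (simp add: algebra_simps)
  qed
qed

section \<open>The summed series: heat equation, regularity and vanishing\<close>

lemma profile_continuous_on: "continuous_on {0..L} (profile k)"
  by (rule DERIV_continuous_on[OF profile_deriv])

lemma profile'_continuous_on: "continuous_on {0..L} (profile' k)"
  by (rule DERIV_continuous_on[OF profile'_deriv])

lemma profile''_continuous_on: "continuous_on {0..L} (profile'' k)"
proof -
  have "continuous_on {0..L} (\<lambda>x. if k = 0 then 0 else profile (k - 1) x)"
    using profile_continuous_on by (cases "k = 0") auto
  then show ?thesis
    unfolding profile''_def[abs_def] using F_cont by (intro continuous_intros)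
qed

text \<open>This is the heat equation. Reindexing pairs \<open>profile k\<close> with
  \<open>g (k + 1)\<close>, which is the time derivative of the temperature; the remaining
  coefficients sum to the source.\<close>

lemma bump_series_profile'':
  assumes "x \<in> {0..L}"
  shows "bump_series profile'' 0 x t = bump_series profile 1 x t - source t * F x"
proof -
  have s: "summable (\<lambda>k. profile k x * g (k + 1) t)"
    by (rule bump_series_summable[OF dominated_profile _ assms]) simp
  define a where "a = (\<lambda>k. (if k = 0 then 0 else profile (k - 1) x) * g k t)"
  have "(\<lambda>k. a (Suc k)) sums bump_series profile 1 x t"
    using s by (simp add: a_def bump_series_def summable_sums)
  then have a: "a sums bump_series profile 1 x t"
    using sums_Suc[of a] by (fastforce simp: a_def)
  have c: "(\<lambda>k. sinh_coeff k * g k t) sums source t"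
    using bump_series_summable[OF dominated_sinh_coeff, of 0 "0 :: real" UNIV t]
    by (simp add: source_def bump_series_def summable_sums)
  have "(\<lambda>k. a k - sinh_coeff k * g k t * F x) sums (bump_series profile 1 x t - source t * F x)"
    by (intro sums_diff a sums_mult2 c)
  then have "(\<lambda>k. profile'' k x * g (k + 0) t) sums (bump_series profile 1 x t - source t * F x)"
    by (simp add: profile''_def a_def algebra_simps)
  then show ?thesis
    by (simp add: bump_series_def sums_iff)
qed

lemma source_deriv: "(source has_real_derivative source' t) (at t)"
  unfolding source_def source'_def
  using bump_series_deriv_time[OF dominated_sinh_coeff, of "0 :: real" UNIV] by simp

lemma source'_continuous: "continuous_on UNIV source'"
proof -
  have "continuous_on (UNIV \<times> UNIV) (\<lambda>(x::real, t). bump_series (\<lambda>k _ :: real. sinh_coeff k) 1 x t)"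
    by (intro bump_series_continuous dominated_sinh_coeff) auto
  then have "continuous_on UNIV ((\<lambda>(x::real, t). bump_series (\<lambda>k _ :: real. sinh_coeff k) 1 x t) \<circ> (\<lambda>t. (0, t)))"
    by (intro continuous_on_compose) (auto intro!: continuous_intros elim: continuous_on_subset)
  then show ?thesis
    by (simp add: o_def source'_def)
qed

lemma source_zero: "t \<le> 0 \<or> T \<le> t \<Longrightarrow> source t = 0"
  by (simp add: source_def bump_series_zero)

text \<open>If the source vanished, then \<open>N = \<Sum>k. sinh_coeff (k + 1) * g k\<close> would satisfy
  \<open>N' = - L * g 0 < 0\<close> on \<open>(0, T)\<close>, although it vanishes at both endpoints.\<close>

lemma source_nonzero: "\<exists>t>0. source t \<noteq> 0"
proof (rule ccontr)
  assume "\<not> (\<exists>t>0. source t \<noteq> 0)"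
  then have zero: "source t = 0" if "0 < t" for t
    using that by blast
  define N where "N = bump_series (\<lambda>k _ :: real. sinh_coeff (Suc k)) 0 0"
  have N: "(N has_real_derivative bump_series (\<lambda>k _ :: real. sinh_coeff (Suc k)) 1 0 t) (at t)" for t
    unfolding N_def using bump_series_deriv_time[OF dominated_sinh_coeff_Suc, of "0 :: real" UNIV] by simp
  have "source t = sinh_coeff 0 * g 0 t + bump_series (\<lambda>k _ :: real. sinh_coeff (Suc k)) 1 0 t" for t
    using suminf_split_head[OF bump_series_summable[OF dominated_sinh_coeff, of 0 "0 :: real" UNIV t]]
    by (simp add: source_def bump_series_def)
  then have N': "(N has_real_derivative - (sinh_coeff 0 * g 0 t)) (at t)" if "0 < t" for t
    using N[of t] zero[OF that] by (metis add.inverse_unique)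
  have "N T < N 0"
  proof (rule DERIV_neg_imp_decreasing_open[OF T_pos])
    fix t assume "0 < t" "t < T"
    then show "\<exists>y. (N has_real_derivative y) (at t) \<and> y < 0"
      using N' bump_pos L_pos by (intro exI[of _ "- (sinh_coeff 0 * g 0 t)"]) (simp add: sinh_coeff_def)
  next
    show "continuous_on {0..T} N"
      using N by (meson DERIV_isCont continuous_at_imp_continuous_on)
  qed
  moreover have "N T = 0" "N 0 = 0"
    by (simp_all add: N_def bump_series_zero)
  ultimately show False
    by simp
qed

lemma temperature_deriv_time:
  assumes "x \<in> {0..L}"
  shows "(temperature x has_real_derivative bump_series profile 1 x t) (at t)"
  unfolding temperature_def using bump_series_deriv_time[OF dominated_profile assms] by simp

lemma temperature_deriv_space:
  assumes "x \<in> {0<..<L}"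
  shows "((\<lambda>x. temperature x t) has_real_derivative bump_series profile' 0 x t) (at x)"
  unfolding temperature_def using assms profile_deriv
  by (intro bump_series_deriv_space[OF dominated_profile dominated_profile']) auto

lemma temperature_deriv_space2:
  assumes "x \<in> {0<..<L}"
  shows "((\<lambda>x. bump_series profile' 0 x t) has_real_derivative bump_series profile'' 0 x t) (at x)"
  using assms profile'_deriv
  by (intro bump_series_deriv_space[OF dominated_profile' dominated_profile'']) auto

lemma temperature_boundary: "temperature 0 t = 0" "temperature L t = 0"
  by (simp_all add: temperature_def bump_series_def profile_0 profile_L)

lemma temperature_zero: "t \<le> 0 \<or> T \<le> t \<Longrightarrow> temperature x t = 0"
  by (simp add: temperature_def bump_series_zero)

end

section \<open>Continuously differentiable functions are locally of class H1\<close>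

lemma continuous_imp_integrable_open_interval:
  fixes h :: "real \<Rightarrow> real"
  assumes "continuous_on {a..b} h"
  shows "integrable (lebesgue_on {a<..<b}) h"
proof -
  have "integrable (lebesgue_on {a..b}) h"
    using assms by (rule continuous_imp_integrable_real)
  then have "set_integrable lebesgue {a..b} h"
    by (simp add: integrable_restrict_space set_integrable_def)
  then have "set_integrable lebesgue {a<..<b} h"
    by (rule set_integrable_subset) auto
  then show ?thesis
    by (simp add: integrable_restrict_space set_integrable_def)
qed

lemma continuous_imp_L2_on:
  assumes "continuous_on UNIV h"
  shows "L2_on {a<..<b} h"
proof -
  have "continuous_on {a..b} h"
    using assms by (rule continuous_on_subset) simp
  then have "integrable (lebesgue_on {a<..<b}) h" "integrable (lebesgue_on {a<..<b}) (\<lambda>t. (h t)\<^sup>2)"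
    by (auto intro!: continuous_imp_integrable_open_interval continuous_intros)
  then show ?thesis
    by (auto simp: L2_on_def)
qed

lemma test_function_real:
  assumes "test_function S \<phi>"
  shows "(\<phi> has_real_derivative deriv \<phi> t) (at t)" and "continuous_on UNIV (deriv \<phi>)"
    and "t \<notin> S \<Longrightarrow> \<phi> t = 0"
proof -
  have smooth: "Ck_on k UNIV \<phi>" for k
    using assms by (simp add: test_function_def smooth_on_def)
  have diff: "\<phi> differentiable (at s)" for s
    using smooth[of 1] by simp
  then have deriv: "(\<phi> has_real_derivative deriv \<phi> s) (at s)" for s
    by (meson DERIV_deriv_iff_real_differentiable)
  then show "(\<phi> has_real_derivative deriv \<phi> t) (at t)" .
  \<comment> \<open>On the real line the derivative in direction 1 is \<open>deriv\<close>, so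
    \<open>Ck_on 1\<close> yields its continuity.\<close>
  have "partial_deriv 1 \<phi> s = deriv \<phi> s" for s
    unfolding partial_deriv_def
    using frechet_derivative_at[OF deriv[of s, unfolded has_field_derivative_def]] by (metis mult_1_right)
  then have "partial_deriv 1 \<phi> = deriv \<phi>"
    by (rule ext)
  moreover have "continuous_on UNIV (partial_deriv 1 \<phi>)"
    using smooth[of 1] by simp
  ultimately show "continuous_on UNIV (deriv \<phi>)"
    by simp
  show "\<phi> t = 0" if "t \<notin> S"
    using assms that closure_subset[of "{x. \<phi> x \<noteq> 0}"] by (auto simp: test_function_def)
qed

text \<open>Integration by parts; the boundary terms vanish because a test function is zero at a and
  b, which lie outside the open interval.\<close>

lemma C1_imp_weak_derivative_on:
  assumes deriv: "\<And>t. (h has_real_derivative h' t) (at t)" and cont: "continuous_on UNIV h'" and "a < b"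
  shows "weak_derivative_on {a<..<b} h h'"
  unfolding weak_derivative_on_def
proof (intro allI impI)
  fix \<phi> assume "test_function {a<..<b} \<phi>"
  note \<phi> = test_function_real[OF this]
  have h: "continuous_on UNIV h"
    using deriv by (rule DERIV_continuous_on)
  have \<phi>_cont: "continuous_on UNIV \<phi>"
    using \<phi>(1) by (rule DERIV_continuous_on)
  have c: "continuous_on {a..b} (\<lambda>t. h t * deriv \<phi> t)" "continuous_on {a..b} (\<lambda>t. h' t * \<phi> t)"
    using h \<phi>_cont cont \<phi>(2) by (auto intro!: continuous_on_mult elim: continuous_on_subset)
  have "((\<lambda>t. h t * deriv \<phi> t + h' t * \<phi> t) has_integral h b * \<phi> b - h a * \<phi> a) {a..b}"
  proof (rule fundamental_theorem_of_calculus)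
    fix t assume "t \<in> {a..b}"
    have "((\<lambda>t. h t * \<phi> t) has_real_derivative h t * deriv \<phi> t + h' t * \<phi> t) (at t)"
      using DERIV_mult'[OF deriv \<phi>(1)] .
    then show "((\<lambda>t. h t * \<phi> t) has_vector_derivative h t * deriv \<phi> t + h' t * \<phi> t) (at t within {a..b})"
      by (simp add: has_field_derivative_at_within flip: has_real_derivative_iff_has_vector_derivative)
  qed (use \<open>a < b\<close> in simp)
  then have "integral {a..b} (\<lambda>t. h t * deriv \<phi> t + h' t * \<phi> t) = 0"
    using \<phi>(3)[of a] \<phi>(3)[of b] by (simp add: integral_unique)
  then have "integral {a..b} (\<lambda>t. h t * deriv \<phi> t) = - integral {a..b} (\<lambda>t. h' t * \<phi> t)"
    using c by (simp add: Henstock_Kurzweil_Integration.integral_add integrable_continuous_interval)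
  then show "(LINT t|lebesgue_on {a<..<b}. h t * deriv \<phi> t) = - (LINT t|lebesgue_on {a<..<b}. h' t * \<phi> t)"
    using c by (simp add: lebesgue_integral_eq_integral continuous_imp_integrable_open_interval
        flip: integral_open_interval_real)
qed

lemma C1_imp_H1_loc:
  assumes deriv: "\<And>t. (h has_real_derivative h' t) (at t)" and cont: "continuous_on UNIV h'"
  shows "H1_loc h"
  unfolding H1_loc_def H1_on_def
proof (intro allI impI conjI exI[of _ h'])
  have "continuous_on UNIV h"
    using deriv by (rule DERIV_continuous_on)
  then show "L2_on {0<..<T0} h" for T0
    by (rule continuous_imp_L2_on)
qed (use assms in \<open>auto intro: continuous_imp_L2_on C1_imp_weak_derivative_on\<close>)

section \<open>One-dimensional Euclidean spaces\<close>

lemma open_interval_eq_inner: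
  fixes \<Omega> :: "'a::euclidean_space set"
  assumes e: "(Basis :: 'a set) = {e}" and "open \<Omega>" "connected \<Omega>" "\<Omega> \<noteq> {}" "bounded \<Omega>"
  obtains a b where "a < b" "\<Omega> = {x. a < x \<bullet> e \<and> x \<bullet> e < b}"
proof -
  have rep: "x = (x \<bullet> e) *\<^sub>R e" for x :: 'a
    using euclidean_representation[of x, unfolded e] by simp
  have "norm e = 1"
    using e by (metis insertI1 norm_Basis)
  then have ee: "e \<bullet> e = 1"
    by (simp add: norm_eq_1)
  define I where "I = (\<lambda>x. x \<bullet> e) ` \<Omega>"
  have mem: "x \<in> \<Omega> \<longleftrightarrow> x \<bullet> e \<in> I" for x
  proof
    assume "x \<bullet> e \<in> I"
    then obtain y where "y \<in> \<Omega>" "x \<bullet> e = y \<bullet> e"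
      by (auto simp: I_def)
    then show "x \<in> \<Omega>"
      using rep[of x] rep[of y] by simp
  qed (simp add: I_def)
  \<comment> \<open>As a preimage I inherits openness; as an image it inherits connectedness and
    boundedness.\<close>
  have "I = (\<lambda>s. s *\<^sub>R e) -` \<Omega>"
    unfolding vimage_def mem by (simp add: ee)
  then have "open I"
    using \<open>open \<Omega>\<close> by (simp add: continuous_open_vimage)
  moreover have "connected I"
    unfolding I_def using \<open>connected \<Omega>\<close> by (intro connected_continuous_image continuous_intros)
  moreover have "bounded I"
    unfolding I_def by (intro bounded_linear_image[OF \<open>bounded \<Omega>\<close>] bounded_linear_inner_left)
  moreover have "I \<noteq> {}"
    using \<open>\<Omega> \<noteq> {}\<close> by (simp add: I_def)
  ultimately obtain a b where ab: "I = {a<..<b}" "a < b"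
  proof -
    define a b where "a = Inf I" and "b = Sup I"
    have bd: "bdd_below I" "bdd_above I"
      using \<open>bounded I\<close> by (auto simp: bounded_imp_bdd_below bounded_imp_bdd_above)
    have "I = {a<..<b}"
    proof
      show "I \<subseteq> {a<..<b}"
      proof
        fix s assume s: "s \<in> I"
        then obtain d where d: "0 < d" "cball s d \<subseteq> I"
          using \<open>open I\<close> open_contains_cball by blast
        then have "s - d \<in> I" "s + d \<in> I"
          by (auto simp: subset_iff dist_real_def)
        then have "a \<le> s - d" "s + d \<le> b"
          using bd by (auto simp: a_def b_def cInf_lower cSup_upper)
        then show "s \<in> {a<..<b}"
          using d by auto
      qed
      show "{a<..<b} \<subseteq> I"
      proof
        fix s assume "s \<in> {a<..<b}"
        then obtain p q where "p \<in> I" "p < s" "q \<in> I" "s < q"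
          using bd \<open>I \<noteq> {}\<close> unfolding a_def b_def
          by (metis greaterThanLessThan_iff cInf_less_iff less_cSup_iff)
        then show "s \<in> I"
          using \<open>connected I\<close> by (meson connected_contains_Icc atLeastAtMost_iff less_imp_le subsetD)
      qed
    qed
    then show thesis
      using that \<open>I \<noteq> {}\<close> by auto
  qed
  show thesis
    using that[OF ab(2)] mem ab(1) by auto
qed

text \<open>The formula for w is required only on an open set, and with a factor c. So the lemma
  applies again to a first partial derivative, known on the domain alone, with v . e absorbed into
  c.\<close>

lemma partial_deriv_inner:
  assumes "(h has_real_derivative h') (at (x \<bullet> e - a))"
    and "open S" and "x \<in> S" and "\<And>y. y \<in> S \<Longrightarrow> w y = c * h (y \<bullet> e - a)"
  shows "w differentiable (at x)" and "partial_deriv v w x = c * h' * (v \<bullet> e)"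
proof -
  have "((\<lambda>y. h (y \<bullet> e - a)) has_derivative (\<lambda>v. (v \<bullet> e) *\<^sub>R h')) (at x)"
  proof (rule has_derivative_compose[of "\<lambda>y. y \<bullet> e - a" "\<lambda>v. v \<bullet> e" x UNIV h "\<lambda>s. s *\<^sub>R h'"])
    show "((\<lambda>y. y \<bullet> e - a) has_derivative (\<lambda>v. v \<bullet> e)) (at x)"
      by (auto intro!: derivative_eq_intros)
    show "(h has_derivative (\<lambda>s. s *\<^sub>R h')) (at (x \<bullet> e - a))"
      using assms(1) by (simp add: has_field_derivative_def mult.commute[of _ h'])
  qed
  then have "((\<lambda>y. c * h (y \<bullet> e - a)) has_derivative (\<lambda>v. c * ((v \<bullet> e) *\<^sub>R h'))) (at x)"
    by (rule has_derivative_mult_right)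
  then have "(w has_derivative (\<lambda>v. c * ((v \<bullet> e) *\<^sub>R h'))) (at x)"
    by (rule has_derivative_transform_within_open[OF _ assms(2,3)]) (simp add: assms(4))
  then show "w differentiable (at x)" "partial_deriv v w x = c * h' * (v \<bullet> e)"
    using frechet_derivative_at[of w _ x, symmetric] by (auto simp: differentiable_def partial_deriv_def)
qed

section \<open>Transfer to a one-dimensional domain and failure of uniqueness\<close>

context flat_heat_source
begin

lemma source_admissible:
  assumes "c \<noteq> 0"
  shows "(\<lambda>t. c * source t) \<in> admissible T"
proof -
  have deriv: "((\<lambda>t. c * source t) has_real_derivative c * source' t) (at t)" for t
    by (rule DERIV_cmult[OF source_deriv])
  have "H1_loc (\<lambda>t. c * source t)"
    by (rule C1_imp_H1_loc[OF deriv]) (intro continuous_intros source'_continuous)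
  moreover have "continuous_on {0<..} (\<lambda>t. c * source t)"
    using deriv by (meson DERIV_isCont continuous_at_imp_continuous_on)
  ultimately show ?thesis
    using assms source_nonzero source_zero by (auto simp: admissible_def)
qed

lemma heat_solution_temperature:
  fixes \<Omega> :: "'b::euclidean_space set" and a c :: real
  assumes e: "(Basis :: 'b set) = {e}"
    and \<Omega>: "\<Omega> = {x. a < x \<bullet> e \<and> x \<bullet> e < a + L}"
    and f: "\<And>x. x \<in> \<Omega> \<Longrightarrow> f x = F (x \<bullet> e - a)"
  shows "heat_solution \<Omega> f (\<lambda>t. c * source t) (\<lambda>x t. c * temperature (x \<bullet> e - a) t)"
proof -
  have ee: "e \<bullet> e = 1"
    using e by (metis insertI1 inner_same_Basis)
  have opn: "open \<Omega>"
    unfolding \<Omega> by (intro open_Collect_conj open_Collect_less continuous_intros)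
  have "closed {x :: 'b. a \<le> x \<bullet> e \<and> x \<bullet> e \<le> a + L}"
    by (intro closed_Collect_conj closed_Collect_le continuous_intros)
  then have clos: "closure \<Omega> \<subseteq> {x. a \<le> x \<bullet> e \<and> x \<bullet> e \<le> a + L}"
    by (intro closure_minimal) (auto simp: \<Omega>)
  have mem: "x \<bullet> e - a \<in> {0<..<L}" "x \<bullet> e - a \<in> {0..L}" if "x \<in> \<Omega>" for x
    using that by (auto simp: \<Omega>)

  \<comment> \<open>Allowing any S inside the closure treats u up to the boundary and its
    derivatives in the interior alike.\<close>
  have cont: "continuous_on (S \<times> A) (\<lambda>(x, t). k * h (x \<bullet> e - a) t)"
    if "continuous_on ({0..L} \<times> UNIV) (\<lambda>(s, t). h s t)" and "S \<subseteq> closure \<Omega>"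
    for S :: "'b set" and A :: "real set" and h and k :: real
  proof -
    have "continuous_on (S \<times> A) (\<lambda>z. (\<lambda>(s, t). h s t) (fst z \<bullet> e - a, snd z))"
      by (rule continuous_on_compose2[OF that(1)]) (use that(2) clos in \<open>auto intro!: continuous_intros\<close>)
    then show ?thesis
      by (auto simp: case_prod_beta' intro!: continuous_intros)
  qed

  define u where "u = (\<lambda>x t. c * temperature (x \<bullet> e - a) t)"
  have time: "((\<lambda>s. u x s) has_real_derivative c * bump_series profile 1 (x \<bullet> e - a) t) (at t)"
    if "x \<in> \<Omega>" for x t
    unfolding u_def by (rule DERIV_cmult[OF temperature_deriv_time[OF mem(2)[OF that]]])
  have first: "(\<lambda>y. u y t) differentiable (at x)"
      "partial_deriv v (\<lambda>y. u y t) x = c * bump_series profile' 0 (x \<bullet> e - a) t * (v \<bullet> e)"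
    if "x \<in> \<Omega>" for x v t
    using partial_deriv_inner[OF temperature_deriv_space[OF mem(1)[OF that], of t] opn that, of "\<lambda>y. u y t" c]
    by (simp_all add: u_def)
  have second: "partial_deriv v (\<lambda>y. u y t) differentiable (at x)"
      "partial_deriv v' (partial_deriv v (\<lambda>y. u y t)) x
        = c * (v \<bullet> e) * bump_series profile'' 0 (x \<bullet> e - a) t * (v' \<bullet> e)"
    if "x \<in> \<Omega>" for x v v' t
    using partial_deriv_inner[OF temperature_deriv_space2[OF mem(1)[OF that], of t] opn that,
        of "partial_deriv v (\<lambda>y. u y t)" "c * (v \<bullet> e)"] first(2)
    by (simp_all add: mult_ac)

  have cont0: "continuous_on ({0..L} \<times> UNIV) (\<lambda>(s, t). temperature s t)"
    unfolding temperature_def by (intro bump_series_continuous dominated_profile profile_continuous_on) simp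
  have contt: "continuous_on ({0..L} \<times> UNIV) (\<lambda>(s, t). bump_series profile 1 s t)"
    by (intro bump_series_continuous dominated_profile profile_continuous_on) simp
  have cont1: "continuous_on ({0..L} \<times> UNIV) (\<lambda>(s, t). bump_series profile' 0 s t)"
    by (intro bump_series_continuous dominated_profile' profile'_continuous_on) simp
  have cont2: "continuous_on ({0..L} \<times> UNIV) (\<lambda>(s, t). bump_series profile'' 0 s t)"
    by (intro bump_series_continuous dominated_profile'' profile''_continuous_on) simp

  have second_cont: "continuous_on (\<Omega> \<times> A) (\<lambda>(x, t). partial_deriv v' (partial_deriv v (\<lambda>y. u y t)) x)"
    for v v' A
  proof (rule continuous_on_eq)
    show "continuous_on (\<Omega> \<times> A) (\<lambda>(x, t). c * (v \<bullet> e) * (v' \<bullet> e) * bump_series profile'' 0 (x \<bullet> e - a) t)"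
      by (rule cont[OF cont2 closure_subset])
  qed (auto simp: second)

  have "C21_on \<Omega> u"
    unfolding C21_on_def
  proof (intro conjI ballI allI impI)
    fix x t assume "x \<in> \<Omega>"
    then show "u x differentiable (at t)"
      using time by (auto simp: real_differentiable_def)
  next
    fix t :: real
    have "continuous_on \<Omega> (partial_deriv v' (partial_deriv v (\<lambda>y. u y t)))" for v v'
    proof -
      have "continuous_on \<Omega> (\<lambda>x. (\<lambda>(x, t). partial_deriv v' (partial_deriv v (\<lambda>y. u y t)) x) (x, t))"
        by (rule continuous_on_compose2[OF second_cont[of UNIV]]) (auto intro!: continuous_intros)
      then show ?thesis
        by simp
    qed
    then show "Ck_on 2 \<Omega> (\<lambda>x. u x t)"
      using first(1) second(1) by (simp add: numeral_2_eq_2)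
  next
    show "continuous_on (\<Omega> \<times> {0<..}) (\<lambda>(x, t). deriv (u x) t)"
    proof (rule continuous_on_eq)
      show "continuous_on (\<Omega> \<times> {0<..}) (\<lambda>(x, t). c * bump_series profile 1 (x \<bullet> e - a) t)"
        by (rule cont[OF contt closure_subset])
    qed (auto simp: DERIV_imp_deriv[OF time])
  next
    fix i
    show "continuous_on (\<Omega> \<times> {0<..}) (\<lambda>(x, t). partial_deriv i (\<lambda>y. u y t) x)"
    proof (rule continuous_on_eq)
      show "continuous_on (\<Omega> \<times> {0<..}) (\<lambda>(x, t). c * (i \<bullet> e) * bump_series profile' 0 (x \<bullet> e - a) t)"
        by (rule cont[OF cont1 closure_subset])
    qed (auto simp: first)
  qed (rule second_cont)
  moreover have "continuous_on (closure \<Omega> \<times> {0..}) (\<lambda>(x, t). u x t)"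
    unfolding u_def by (rule cont[OF cont0 order_refl])
  moreover have "deriv (u x) t = laplacian (\<lambda>y. u y t) x + c * source t * f x" if "x \<in> \<Omega>" for x t
    by (simp add: laplacian_def e second[OF that] ee DERIV_imp_deriv[OF time[OF that]] f[OF that]
        bump_series_profile''[OF mem(2)[OF that]] right_diff_distrib mult.assoc)
  moreover have "u x 0 = 0" for x
    by (simp add: u_def temperature_zero)
  moreover have "u x t = 0" if "x \<in> frontier \<Omega>" for x t
  proof -
    have "x \<notin> \<Omega>" "x \<in> closure \<Omega>"
      using that opn by (auto simp: frontier_def interior_open)
    then have "x \<bullet> e - a = 0 \<or> x \<bullet> e - a = L"
      using clos by (auto simp: \<Omega>)
    then show ?thesis
      using temperature_boundary by (elim disjE) (simp_all add: u_def)
  qed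
  ultimately show ?thesis
    by (simp add: heat_solution_def flip: u_def)
qed

end

text \<open>The zero source is not admissible, so by linearity \<open>source\<close> is compared
  with its double. Both temperatures vanish from time T on, hence throughout (T1, T2), while the
  sources differ wherever \<open>source\<close> is non-zero.\<close>

lemma not_uniqueness_holds_dim1:
  fixes \<Omega> :: "'a::euclidean_space set" and f :: "'a \<Rightarrow> real"
  assumes dim: "DIM('a) = 1" and \<Omega>: "smooth_bounded_domain \<Omega>" and T: "0 < T" "T < T1"
    and f: "continuous_on UNIV f"
  shows "\<not> uniqueness_holds \<Omega> T T1 T2 f x0"
proof
  assume uniq: "uniqueness_holds \<Omega> T T1 T2 f x0"
  obtain e where e: "(Basis :: 'a set) = {e}"
    using dim card_1_singletonE by blast
  obtain a b where ab: "a < b" "\<Omega> = {x. a < x \<bullet> e \<and> x \<bullet> e < b}"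
    using open_interval_eq_inner[OF e] \<Omega> unfolding smooth_bounded_domain_def by metis
  define L where "L = b - a"
  define F where "F = (\<lambda>s. f ((s + a) *\<^sub>R e))"
  have "0 < 1 / (8 * L\<^sup>2)"
    using ab by (simp add: L_def)
  from gevrey_bump_exists[OF T(1) this] obtain g where
    "\<forall>k t. (g k has_real_derivative g (Suc k) t) (at t)"
    "\<forall>k t. \<bar>g k t\<bar> \<le> (fact k)\<^sup>2 * (1 / (8 * L\<^sup>2)) ^ k"
    "\<forall>k t. t \<le> 0 \<or> T \<le> t \<longrightarrow> g k t = 0"
    "\<forall>t. 0 < t \<and> t < T \<longrightarrow> 0 < g 0 t"
    by blast
  moreover have "continuous_on {0..L} F"
    unfolding F_def by (rule continuous_on_compose2[OF f]) (auto intro!: continuous_intros)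
  ultimately interpret flat_heat_source g T L F
    using T ab by unfold_locales (auto simp: L_def)
  have fF: "f x = F (x \<bullet> e - a)" for x
    using euclidean_representation[of x, unfolded e] by (simp add: F_def)
  have sol: "heat_solution \<Omega> f (\<lambda>t. c * source t) (\<lambda>x t. c * temperature (x \<bullet> e - a) t)" for c
    by (rule heat_solution_temperature[OF e]) (auto simp: ab L_def fF)
  have "\<forall>t. T1 < t \<and> t < T2 \<longrightarrow> 1 * temperature (x0 \<bullet> e - a) t = 2 * temperature (x0 \<bullet> e - a) t"
    using T by (simp add: temperature_zero)
  then have "\<forall>t. 0 < t \<and> t < T \<longrightarrow> 1 * source t = 2 * source t"
    using uniq[unfolded uniqueness_holds_def, rule_format,
        OF source_admissible[of 1] source_admissible[of 2] sol[of 1] sol[of 2]] by simp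
  moreover obtain t where "0 < t" "source t \<noteq> 0"
    using source_nonzero by blast
  ultimately show False
    using source_zero[of t] by force
qed

theorem mainTheorem3:
  fixes \<Omega> :: "'a::euclidean_space set"
    and f :: "'a \<Rightarrow> real"
    and x0 :: 'a
    and T T1 T2 :: real
  assumes "smooth_bounded_domain \<Omega>"
    and "0 < T" and "T < T1" and "T1 < T2"
    and "test_function \<Omega> f" and "\<exists>x. f x \<noteq> 0"
    and "x0 \<in> \<Omega>"
  shows "(uniqueness_holds \<Omega> T T1 T2 f x0 \<longrightarrow> DIM('a) \<ge> 2) \<and>
         (DIM('a) = 1 \<longrightarrow> \<not> uniqueness_holds \<Omega> T T1 T2 f x0)"
proof -
  have "Ck_on 0 UNIV f"
    using assms(5) unfolding test_function_def smooth_on_def by blast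
  then have "\<not> uniqueness_holds \<Omega> T T1 T2 f x0" if "DIM('a) = 1"
    using not_uniqueness_holds_dim1[OF that assms(1-3)] by simp
  moreover have "DIM('a) = 1 \<or> DIM('a) \<ge> 2"
    using DIM_positive[where 'a = 'a] by linarith
  ultimately show ?thesis
    by blast
qed

end
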